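(* Let $r\ge 1$ be an integer and let $\mathcal{F}$ be a count statistical model parameterized by its first $r$ factorial cumulants $\theta=(\kappa_{(1)},\kappa_{(2)},\ldots,\kappa_{(r)})\in\Theta\subset\mathbb{R}^r$, with probability generating functions $\Phi(t;\theta)$ continuous in $\theta\in\Theta$, and with parameter domain $\Theta$ the widest possible. Then $\mathcal{F}$ is closed under addition and closed under binomial subsampling if and only if, for all $\theta\in\Theta$, $$\Phi(t;\theta)=\exp\left\{\sum_{i=1}^{r}\frac{\kappa_{(i)}}{i!}(t-1)^i\right\}.$$
   Context: A count random variable is a random variable with values in $\{0,1,2,\ldots\}$; its probability generating function (pgf) is $\Phi_X(t)=\mathrm{E}(t^X)$. Its $k$th factorial cumulant $\kappa_{(k)}$ is the $k$th derivative of $\log\Phi_X(t)$ at $t=1$ (derivatives at $t=1$ taken from the left when necessary); in particular $\kappa_{(1)}=\mathrm{E}(X)$. A count statistical model $\mathcal{F}$ with parameter domain $\Theta\subset\mathbb{R}^r$ (nonempty) is a set of distributions of count random variables indexed by $\theta\in\Theta$, identified with a continuous function $\Phi:(0,1)\times\Theta\to\mathbb{R}$ such that for each $\theta\in\Theta$ the function $t\mapsto\Phi(t;\theta)$ is (the restriction to $(0,1)$ of) the pgf of the corresponding distribution. "Parameterized by its first $r$ factorial cumulants" means that the distribution with parameter $\theta=(\kappa_{(1)},\ldots,\kappa_{(r)})$ has finite factorial cumulants of orders $1,\ldots,r$, equal to $\kappa_{(1)},\ldots,\kappa_{(r)}$. "The parameter domain is the widest possible" means that there is no parameter value outside $\Theta$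 at which the expression defining the family is still a pgf. For this statement: if $\Phi(t;\theta)=\exp\{\sum_{i=1}^{r}\kappa_{(i)}(t-1)^i/i!\}$ for all $\theta\in\Theta$, then $\Theta$ contains every $\theta=(\kappa_{(1)},\ldots,\kappa_{(r)})\in\mathbb{R}^r$ with $\kappa_{(1)}>0$ for which $t\mapsto\exp\{\sum_{i=1}^{r}\kappa_{(i)}(t-1)^i/i!\}$ is a pgf. Binomial subsampling: for a count random variable $X$ and $p\in(0,1]$, let $\xi_1,\xi_2,\ldots$ be i.i.d. Bernoulli variables with success probability $p$, independent of $X$; the variable $X_p=\xi_1+\cdots+\xi_X$ ($X_p=0$ if $X=0$) is called an independent $p$-thinning, or binomial subsampling, of $X$. The model $\mathcal{F}$ is closed under binomial subsampling if for every $X$ with distribution in $\mathcal{F}$ and every $p\in(0,1]$ the distribution of $X_p$ belongs to $\mathcal{F}$. The model $\mathcal{F}$ is closed under addition if for any two independent random variables $X,Y$ with distributions in $\mathcal{F}$ the distribution of $X+Y$ belongs to $\mathcal{F}$. *)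

theory Defs
  imports "HOL-Probability.Probability"
begin

text \<open>
  Count distributions are probability mass functions on the naturals.
\<close>

definition pgf :: "nat pmf \<Rightarrow> real \<Rightarrow> real" where
  "pgf X t = measure_pmf.expectation X (\<lambda>n. t ^ n)"

definition is_pgf :: "(real \<Rightarrow> real) \<Rightarrow> bool" where
  "is_pgf f \<longleftrightarrow> (\<exists>X. \<forall>t\<in>{0<..<1}. f t = pgf X t)"

text \<open>
  \<open>D j\<close> is the \<open>j\<close>-th derivative of \<open>ln \<circ> pgf X\<close> on \<open>(0,1]\<close>; the filter
  \<open>at t within {0<..1}\<close> makes it the left derivative at \<open>t = 1\<close>. The predicate asserts
  both that the \<open>k\<close>-th factorial cumulant is finite and that its value is \<open>c\<close>.
  The point 0 is left out because \<open>pgf X 0\<close> may vanish.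
\<close>

definition has_factorial_cumulant :: "nat pmf \<Rightarrow> nat \<Rightarrow> real \<Rightarrow> bool" where
  "has_factorial_cumulant X k c \<longleftrightarrow>
     (\<exists>D :: nat \<Rightarrow> real \<Rightarrow> real.
        (\<forall>t\<in>{0<..1}. D 0 t = ln (pgf X t)) \<and>
        (\<forall>j<k. \<forall>t\<in>{0<..1}. (D j has_real_derivative D (Suc j) t) (at t within {0<..1})) \<and>
        D k 1 = c)"

text \<open>
  A point of \<open>r\<close>-dimensional Euclidean space is a function in \<open>{1..r} \<rightarrow>\<^sub>E UNIV\<close>, so
  that \<open>\<theta> i\<close> is the \<open>i\<close>-th coordinate, counted from 1. The topology that this set inherits from the
  product topology on \<open>nat \<Rightarrow> real\<close> is the Euclidean one, since all coordinates outside
  \<open>{1..r}\<close> are constant on it.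

  \<open>F \<theta>\<close> is the distribution with parameter \<open>\<theta>\<close>; as a set of distributions the
  model is \<open>F ` \<Theta>\<close>. Values of \<open>F\<close> and \<open>\<Phi>\<close> outside \<open>\<Theta>\<close>, or outside
  \<open>(0,1) \<times> \<Theta>\<close> respectively, are irrelevant.
\<close>

definition count_model ::
    "nat \<Rightarrow> (nat \<Rightarrow> real) set \<Rightarrow> ((nat \<Rightarrow> real) \<Rightarrow> nat pmf) \<Rightarrow> (real \<Rightarrow> (nat \<Rightarrow> real) \<Rightarrow> real) \<Rightarrow> bool" where
  "count_model r \<Theta> F \<Phi> \<longleftrightarrow>
     \<Theta> \<noteq> {} \<and> \<Theta> \<subseteq> ({1..r} \<rightarrow>\<^sub>E UNIV) \<and>
     (\<forall>\<theta>\<in>\<Theta>. \<forall>t\<in>{0<..<1}. \<Phi> t \<theta> = pgf (F \<theta>) t) \<and>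
     continuous_on ({0<..<1} \<times> \<Theta>) (\<lambda>(t, \<theta>). \<Phi> t \<theta>)"

definition parameterized_by_factorial_cumulants ::
    "nat \<Rightarrow> (nat \<Rightarrow> real) set \<Rightarrow> ((nat \<Rightarrow> real) \<Rightarrow> nat pmf) \<Rightarrow> bool" where
  "parameterized_by_factorial_cumulants r \<Theta> F \<longleftrightarrow>
     (\<forall>\<theta>\<in>\<Theta>. \<forall>k\<in>{1..r}. has_factorial_cumulant (F \<theta>) k (\<theta> k))"

definition widest_parameter_domain ::
    "nat \<Rightarrow> (nat \<Rightarrow> real) set \<Rightarrow> (real \<Rightarrow> (nat \<Rightarrow> real) \<Rightarrow> real) \<Rightarrow> bool" where
  "widest_parameter_domain r \<Theta> \<Phi> \<longleftrightarrow>
     ((\<forall>\<theta>\<in>\<Theta>. \<forall>t\<in>{0<..<1}. \<Phi> t \<theta> = exp (\<Sum>i=1..r. \<theta> i / fact i * (t - 1) ^ i)) \<longrightarrow>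
      (\<forall>\<theta>\<in>{1..r} \<rightarrow>\<^sub>E UNIV.
         \<theta> 1 > 0 \<and> is_pgf (\<lambda>t. exp (\<Sum>i=1..r. \<theta> i / fact i * (t - 1) ^ i)) \<longrightarrow> \<theta> \<in> \<Theta>))"

text \<open>
  Given \<open>X = n\<close>, the thinned variable is the sum of \<open>n\<close> independent Bernoulli
  variables \<open>\<xi> 1, \<dots>, \<xi> n\<close>. The second argument of \<open>Pi_pmf\<close> is only a default value
  outside the index set.
\<close>

definition thinning :: "real \<Rightarrow> nat pmf \<Rightarrow> nat pmf" where
  "thinning p X =
     bind_pmf X (\<lambda>n. map_pmf (\<lambda>\<xi>. \<Sum>i=1..n. of_bool (\<xi> i))
       (Pi_pmf {1..n} False (\<lambda>_. bernoulli_pmf p)))"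

definition closed_under_binomial_subsampling :: "nat pmf set \<Rightarrow> bool" where
  "closed_under_binomial_subsampling \<F> \<longleftrightarrow> (\<forall>X\<in>\<F>. \<forall>p\<in>{0<..1}. thinning p X \<in> \<F>)"

text \<open>\<open>pair_pmf X Y\<close> is the joint law of independent variables with laws \<open>X\<close> and \<open>Y\<close>.\<close>

definition closed_under_addition :: "nat pmf set \<Rightarrow> bool" where
  "closed_under_addition \<F> \<longleftrightarrow>
     (\<forall>X\<in>\<F>. \<forall>Y\<in>\<F>. map_pmf (\<lambda>(x, y). x + y) (pair_pmf X Y) \<in> \<F>)"

end

theory Submission
  imports Defs "HOL-Complex_Analysis.Cauchy_Integral_Formula"
begin

text \<open>
  The \<open>i\<close>-th factorial cumulant is additive over independent sums, and \<open>p\<close>-thinning multiplies it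
  by \<open>p ^ i\<close>; on generating functions these operations are multiplication and the substitution
  of \<open>1 - p + p * t\<close> for \<open>t\<close>. As a law with finite mean 0 is the point mass at 0, and a law is
  determined by its generating function on \<open>(0,1)\<close>, a model with polynomial logarithms of the
  generating functions and the widest parameter domain is closed (\<open>closed_if_pgf_eq_exp\<close>).

  For the converse, fix \<open>\<theta>\<close> and \<open>u = 1 - t\<close>, and let \<open>e p\<close> be the error at \<open>1 - p * u\<close> of the
  Taylor polynomial of degree \<open>r\<close> at 1 of the logarithm of the generating function; the claim is
  \<open>e 1 = 0\<close>. In a closed model \<open>e p\<close> is the value of an additive function of the parameter at
  \<open>(p * \<theta> 1, \<dots>, p ^ r * \<theta> r)\<close>. Hence two finite sums of values of \<open>e\<close> agree as soon as the sums
  of the first \<open>r\<close> powers of their arguments do. In particular the differences of order \<open>r + 1\<close>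
  of \<open>e\<close> on equidistant grids vanish (\<open>fdiff_additive_eq_zero\<close>), for they annihilate the powers
  of exponent at most \<open>r\<close>. So along the grid of mesh \<open>1 / N\<close> the function \<open>e\<close> grows by a factor of
  order \<open>N ^ r\<close> at most (\<open>fdiff_growth\<close>). Its first values are of order \<open>o(1 / N ^ r)\<close> by Taylor's
  formula (\<open>taylor_peano_left\<close>), which needs only the \<open>r\<close> left derivatives given by the
  cumulants. Letting \<open>N\<close> tend to infinity gives \<open>e 1 = 0\<close> (\<open>flat_zero_fdiff_imp_zero\<close>).
\<close>

section \<open>Probability generating functions\<close>

lemma integrable_pgf:
  assumes "0 \<le> t" "t \<le> 1"
  shows "integrable (measure_pmf X) (\<lambda>n::nat. t ^ n :: real)"
  by (rule measure_pmf.integrable_const_bound[where B = 1])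
     (use assms in \<open>auto simp: power_le_one\<close>)

lemma pgf_one [simp]: "pgf X 1 = 1"
  by (simp add: pgf_def)

lemma pgf_nonneg:
  assumes "0 \<le> t"
  shows "0 \<le> pgf X t"
  unfolding pgf_def using assms by (intro integral_nonneg_AE) auto

lemma ennreal_pgf:
  assumes "0 \<le> t" "t \<le> 1"
  shows "ennreal (pgf X t) = (\<integral>\<^sup>+n. ennreal (t ^ n) \<partial>measure_pmf X)"
  unfolding pgf_def
  by (rule nn_integral_eq_integral[symmetric])
     (use assms in \<open>auto intro: integrable_pgf\<close>)

lemma pgf_pos:
  assumes "0 < t" "t \<le> 1"
  shows "0 < pgf X t"
proof -
  obtain m where m: "m \<in> set_pmf X"
    using set_pmf_not_empty by fast
  have "(\<integral>n. t ^ m * indicator {m} n \<partial>measure_pmf X) \<le> pgf X t"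
    unfolding pgf_def
    by (rule integral_mono)
       (use assms in \<open>auto intro!: integrable_pgf measure_pmf.integrable_const_bound[where B = 1]
          simp: indicator_def power_le_one\<close>)
  moreover have "(\<integral>n. t ^ m * indicator {m} n \<partial>measure_pmf X) = t ^ m * pmf X m"
    by (simp add: measure_pmf_single)
  moreover have "0 < t ^ m * pmf X m"
    using assms m by (simp add: pmf_positive)
  ultimately show ?thesis by linarith
qed

lemma pgf_sums:
  assumes "0 \<le> t" "t \<le> 1"
  shows "(\<lambda>n. pmf X n * t ^ n) sums pgf X t"
proof -
  have "integrable (count_space UNIV) (\<lambda>n. pmf X n * t ^ n)"
    using integrable_pgf[OF assms, of X]
    by (simp add: measure_pmf_eq_density integrable_density)
  then have "(\<lambda>n. pmf X n * t ^ n) sums (\<integral>n. pmf X n * t ^ n \<partial>count_space UNIV)"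
    by (rule sums_integral_count_space_nat)
  also have "(\<integral>n. pmf X n * t ^ n \<partial>count_space UNIV) = pgf X t"
    by (simp add: pgf_def measure_pmf_eq_density integral_density)
  finally show ?thesis .
qed

lemma pgf_inject:
  assumes eq: "\<And>t. t \<in> {0<..<1} \<Longrightarrow> pgf X t = pgf Y t"
  shows "X = Y"
proof (rule ccontr)
  assume "X \<noteq> Y"
  then obtain m where m: "pmf X m \<noteq> pmf Y m"
    by (metis pmf_eqI)
  (* The index shift multiplies the difference of the two series by x, so that it vanishes at 0. *)
  define a where "a n = (case n of 0 \<Rightarrow> 0 | Suc k \<Rightarrow> pmf X k - pmf Y k)" for n
  have "\<bar>pmf X k - pmf Y k\<bar> \<le> 1" for k
    using pmf_nonneg[of X k] pmf_nonneg[of Y k] pmf_le_1[of X k] pmf_le_1[of Y k] by linarith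
  then have abs_a: "\<bar>a n\<bar> \<le> 1" for n
    by (simp add: a_def split: nat.split)
  have sums: "(\<lambda>n. a n * x ^ n) sums (\<Sum>n. a n * x ^ n)" if "\<bar>x\<bar> < 1" for x :: real
  proof (rule summable_sums, rule summable_comparison_test')
    show "summable (\<lambda>n. \<bar>x\<bar> ^ n)"
      using that by (intro summable_geometric) auto
    show "norm (a n * x ^ n) \<le> \<bar>x\<bar> ^ n" for n
      using mult_right_mono[OF abs_a[of n], of "\<bar>x\<bar> ^ n"] by (simp add: abs_mult power_abs)
  qed
  obtain s where s: "0 < s" "\<And>z. z \<in> cball 0 s - {0} \<Longrightarrow> (\<Sum>n. a n * z ^ n) \<noteq> 0"
  proof (rule powser_0_nonzero[of 1 0 a "\<lambda>x. \<Sum>n. a n * x ^ n" "Suc m"])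
    show "(\<Sum>n. a n * 0 ^ n) = 0"
      by (subst suminf_finite[of "{0}"]) (auto simp: a_def)
    show "a (Suc m) \<noteq> 0"
      using m by (simp add: a_def)
  qed (use sums in auto)
  define t where "t = min s (1 / 2)"
  have t: "0 < t" "t \<le> s" "t < 1"
    using s(1) by (auto simp: t_def)
  have "(\<lambda>n. pmf X n * t ^ n - pmf Y n * t ^ n) sums (pgf X t - pgf Y t)"
    by (intro sums_diff pgf_sums) (use t in auto)
  then have "(\<lambda>n. t * (pmf X n * t ^ n - pmf Y n * t ^ n)) sums (t * 0)"
    using eq[of t] t by (intro sums_mult) auto
  then have "(\<lambda>n. a (Suc n) * t ^ Suc n) sums 0"
    by (simp add: a_def algebra_simps)
  then have "(\<lambda>n. a n * t ^ n) sums 0"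
    by (subst (asm) sums_Suc_iff) (simp add: a_def)
  then have "(\<Sum>n. a n * t ^ n) = 0"
    by (rule sums_unique[symmetric])
  then show False
    using s(2)[of t] t by auto
qed

lemma pgf_add:
  assumes "0 \<le> t" "t \<le> 1"
  shows "pgf (map_pmf (\<lambda>(x, y). x + y) (pair_pmf X Y)) t = pgf X t * pgf Y t"
proof -
  have "ennreal (pgf (map_pmf (\<lambda>(x, y). x + y) (pair_pmf X Y)) t) =
      (\<integral>\<^sup>+x. \<integral>\<^sup>+y. ennreal (t ^ x) * ennreal (t ^ y) \<partial>measure_pmf Y \<partial>measure_pmf X)"
    using assms by (simp add: ennreal_pgf nn_integral_pair_pmf' power_add ennreal_mult)
  also have "\<dots> = ennreal (pgf X t) * ennreal (pgf Y t)"
    using assms by (simp add: ennreal_pgf nn_integral_cmult nn_integral_multc)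
  finally show ?thesis
    using assms by (simp add: pgf_nonneg flip: ennreal_mult)
qed

text \<open>Given \<open>X = n\<close>, the thinned variable is a sum of \<open>n\<close> Bernoulli variables, each of which
  contributes the factor \<open>1 - p + p * t\<close>.\<close>

lemma pgf_thinning:
  assumes t: "0 \<le> t" "t \<le> 1" and p: "0 \<le> p" "p \<le> 1"
  shows "pgf (thinning p X) t = pgf X (1 - p + p * t)"
proof -
  have q: "0 \<le> 1 - p + p * t" "1 - p + p * t \<le> 1"
    using t p mult_left_le[of t p] by auto
  define B where
    "B n = map_pmf (\<lambda>\<xi>. \<Sum>i=1..n. of_bool (\<xi> i) :: nat) (Pi_pmf {1..n} False (\<lambda>_. bernoulli_pmf p))" for n :: nat
  have "pgf (B n) t = (1 - p + p * t) ^ n" for n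
  proof -
    have "pgf (B n) t = measure_pmf.expectation (Pi_pmf {1..n} False (\<lambda>_. bernoulli_pmf p))
        (\<lambda>\<xi>. \<Prod>i\<in>{1..n}. t ^ (of_bool (\<xi> i) :: nat))"
      by (simp add: pgf_def B_def power_sum del: sum_of_bool_eq)
    also have "\<dots> = (\<Prod>i\<in>{1..n}. measure_pmf.expectation (bernoulli_pmf p) (\<lambda>b. t ^ (of_bool b :: nat)))"
      by (rule expectation_prod_Pi_pmf) (use t in \<open>auto intro: integrable_measure_pmf_finite\<close>)
    also have "\<dots> = (1 - p + p * t) ^ n"
      using p by (simp add: algebra_simps)
    finally show ?thesis .
  qed
  then have B: "(\<integral>\<^sup>+k. ennreal (t ^ k) \<partial>measure_pmf (B n)) = ennreal ((1 - p + p * t) ^ n)" for n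
    using ennreal_pgf[of t "B n"] t by simp
  have "ennreal (pgf (thinning p X) t) = (\<integral>\<^sup>+n. \<integral>\<^sup>+k. ennreal (t ^ k) \<partial>measure_pmf (B n) \<partial>measure_pmf X)"
    using t unfolding thinning_def B_def by (subst ennreal_pgf) (auto simp only: nn_integral_bind_pmf)
  also have "\<dots> = ennreal (pgf X (1 - p + p * t))"
    using q by (simp add: B ennreal_pgf)
  finally show ?thesis
    using t q by (simp add: pgf_nonneg)
qed

section \<open>Factorial cumulants\<close>

lemma at_within_left_unit_neq_bot:
  assumes "t \<in> {0<..1::real}"
  shows "at t within {0<..1} \<noteq> bot"
proof -
  have "at t within {0<..<t} \<le> at t within {0<..1}"
    using assms by (intro at_le) auto
  moreover have "at t within {0<..<t} \<noteq> bot"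
    using assms by (simp add: at_within_eq_bot_iff)
  ultimately show ?thesis
    by (metis bot.extremum_uniqueI)
qed

text \<open>The derivatives in the definition of the cumulants are determined by the law, because every
  point of \<open>(0,1]\<close> is an accumulation point of that interval.\<close>

lemma log_pgf_derivs_unique:
  assumes D: "\<forall>t\<in>{0<..1}. D 0 t = ln (pgf X t)"
      "\<forall>j<k. \<forall>t\<in>{0<..1}. (D j has_real_derivative D (Suc j) t) (at t within {0<..1})"
    and E: "\<forall>t\<in>{0<..1}. E 0 t = ln (pgf X t)"
      "\<forall>j<k. \<forall>t\<in>{0<..1}. (E j has_real_derivative E (Suc j) t) (at t within {0<..1})"
    and "j \<le> k"
  shows "\<forall>t\<in>{0<..1}. D j t = E j t"
  using \<open>j \<le> k\<close>
proof (induction j)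
  case 0
  then show ?case using D E by simp
next
  case (Suc j)
  show ?case
  proof
    fix t :: real assume t: "t \<in> {0<..1}"
    have "(D j has_real_derivative E (Suc j) t) (at t within {0<..1})"
      using Suc E(2) t by (intro has_field_derivative_transform_within[of "E j" _ t _ 1 "D j"]) auto
    then show "D (Suc j) t = E (Suc j) t"
      using D(2) Suc.prems t at_within_left_unit_neq_bot[OF t]
      by (intro has_field_derivative_unique) auto
  qed
qed

lemma has_factorial_cumulant_unique:
  assumes "has_factorial_cumulant X k c" "has_factorial_cumulant X k d"
  shows "c = d"
proof -
  obtain D where D: "\<forall>t\<in>{0<..1}. D 0 t = ln (pgf X t)"
      "\<forall>j<k. \<forall>t\<in>{0<..1}. (D j has_real_derivative D (Suc j) t) (at t within {0<..1})" "D k 1 = c"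
    using assms(1) unfolding has_factorial_cumulant_def by blast
  obtain E where E: "\<forall>t\<in>{0<..1}. E 0 t = ln (pgf X t)"
      "\<forall>j<k. \<forall>t\<in>{0<..1}. (E j has_real_derivative E (Suc j) t) (at t within {0<..1})" "E k 1 = d"
    using assms(2) unfolding has_factorial_cumulant_def by blast
  show ?thesis
    using log_pgf_derivs_unique[OF D(1,2) E(1,2) order.refl] D(3) E(3) by simp
qed

lemma has_factorial_cumulant_add:
  assumes "has_factorial_cumulant X k c" "has_factorial_cumulant Y k d"
  shows "has_factorial_cumulant (map_pmf (\<lambda>(x, y). x + y) (pair_pmf X Y)) k (c + d)"
proof -
  obtain D where D: "\<forall>t\<in>{0<..1}. D 0 t = ln (pgf X t)"
      "\<forall>j<k. \<forall>t\<in>{0<..1}. (D j has_real_derivative D (Suc j) t) (at t within {0<..1})" "D k 1 = c"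
    using assms(1) unfolding has_factorial_cumulant_def by blast
  obtain E where E: "\<forall>t\<in>{0<..1}. E 0 t = ln (pgf Y t)"
      "\<forall>j<k. \<forall>t\<in>{0<..1}. (E j has_real_derivative E (Suc j) t) (at t within {0<..1})" "E k 1 = d"
    using assms(2) unfolding has_factorial_cumulant_def by blast
  show ?thesis
    unfolding has_factorial_cumulant_def
  proof (intro exI[of _ "\<lambda>j t. D j t + E j t"] conjI allI impI ballI)
    fix t :: real assume t: "t \<in> {0<..1}"
    then have "pgf X t > 0" "pgf Y t > 0"
      by (auto intro: pgf_pos)
    then show "D 0 t + E 0 t = ln (pgf (map_pmf (\<lambda>(x, y). x + y) (pair_pmf X Y)) t)"
      using D(1) E(1) t by (simp add: pgf_add ln_mult)
  next
    fix j and t :: real assume "j < k" "t \<in> {0<..1}"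
    then show "((\<lambda>t. D j t + E j t) has_real_derivative D (Suc j) t + E (Suc j) t)
        (at t within {0<..1})"
      using D(2) E(2) by (intro DERIV_add) blast+
  next
    show "D k 1 + E k 1 = c + d"
      using D(3) E(3) by simp
  qed
qed

lemma has_factorial_cumulant_thinning:
  assumes c: "has_factorial_cumulant X k c" and p: "p \<in> {0<..1}"
  shows "has_factorial_cumulant (thinning p X) k (p ^ k * c)"
proof -
  obtain D where D: "\<forall>t\<in>{0<..1}. D 0 t = ln (pgf X t)"
      "\<forall>j<k. \<forall>t\<in>{0<..1}. (D j has_real_derivative D (Suc j) t) (at t within {0<..1})" "D k 1 = c"
    using c unfolding has_factorial_cumulant_def by blast
  have q: "1 - p + p * t \<in> {0<..1}" if "t \<in> {0<..1}" for t :: real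
  proof -
    have "0 < p * t" "p * t \<le> p"
      using that p by (auto simp: mult_left_le)
    then show ?thesis
      using p by simp
  qed
  show ?thesis
    unfolding has_factorial_cumulant_def
  proof (intro exI[of _ "\<lambda>j t. p ^ j * D j (1 - p + p * t)"] conjI allI impI ballI)
    fix t :: real assume t: "t \<in> {0<..1}"
    then show "p ^ 0 * D 0 (1 - p + p * t) = ln (pgf (thinning p X) t)"
      using D(1) q[OF t] p by (simp add: pgf_thinning)
  next
    fix j and t :: real assume j: "j < k" and t: "t \<in> {0<..1}"
    have "(D j has_real_derivative D (Suc j) (1 - p + p * t)) (at (1 - p + p * t) within {0<..1})"
      using D(2) j q[OF t] by blast
    then have "(D j has_real_derivative D (Suc j) (1 - p + p * t))
        (at (1 - p + p * t) within (\<lambda>t. 1 - p + p * t) ` {0<..1})"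
      by (rule DERIV_subset) (use q in blast)
    moreover have "((\<lambda>t. 1 - p + p * t) has_real_derivative p) (at t within {0<..1})"
      by (auto intro!: derivative_eq_intros)
    ultimately have "((\<lambda>t. D j (1 - p + p * t)) has_real_derivative D (Suc j) (1 - p + p * t) * p)
        (at t within {0<..1})"
      using DERIV_image_chain[of "D j" _ "\<lambda>t. 1 - p + p * t"] by (simp add: o_def)
    from DERIV_cmult[OF this, of "p ^ j"]
    show "((\<lambda>t. p ^ j * D j (1 - p + p * t)) has_real_derivative
        p ^ Suc j * D (Suc j) (1 - p + p * t)) (at t within {0<..1})"
      by (simp add: algebra_simps)
  qed (use D(3) in simp)
qed

text \<open>The first cumulant is the mean, which is at least the probability of a nonzero value.\<close>

lemma first_factorial_cumulant_ge:
  assumes "has_factorial_cumulant X 1 c"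
  shows "1 - pmf X 0 \<le> c"
proof -
  obtain D where D: "\<forall>t\<in>{0<..1}. D 0 t = ln (pgf X t)"
      "\<forall>j<1. \<forall>t\<in>{0<..1}. (D j has_real_derivative D (Suc j) t) (at t within {0<..1})" "D 1 1 = c"
    using assms unfolding has_factorial_cumulant_def by blast
  have "((\<lambda>t. (D 0 t - D 0 1) / (t - 1)) \<longlongrightarrow> c) (at 1 within {0<..1})"
    using D(2)[rule_format, of 0 1] D(3) by (simp add: has_field_derivative_iff)
  moreover have "1 - pmf X 0 \<le> (D 0 t - D 0 1) / (t - 1)" if t: "t \<in> {0<..1}" "t \<noteq> 1" for t
  proof -
    have [simp]: "integrable (measure_pmf X) (indicat_real {0})"
      by (rule measure_pmf.integrable_const_bound[where B = 1]) auto
    have "pgf X t \<le> (\<integral>n. t + (1 - t) * indicator {0} n \<partial>measure_pmf X)"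
      unfolding pgf_def
    proof (rule integral_mono)
      show "t ^ n \<le> t + (1 - t) * indicator {0} n" for n :: nat
        using t power_decreasing[of 1 n t] by (cases n) auto
    qed (use t in \<open>auto intro!: integrable_pgf\<close>)
    also have "\<dots> = t + (1 - t) * pmf X 0"
      by (simp add: measure_pmf_single)
    finally have "ln (pgf X t) \<le> t + (1 - t) * pmf X 0 - 1"
      using ln_le_minus_one[of "pgf X t"] pgf_pos[of t X] t by auto
    also have "\<dots> = (1 - pmf X 0) * (t - 1)"
      by (simp add: algebra_simps)
    finally show ?thesis
      using t D(1) by (simp add: neg_le_divide_eq)
  qed
  ultimately show ?thesis
    using at_within_left_unit_neq_bot[of 1]
    by (intro tendsto_lowerbound[of _ c "at 1 within {0<..1}"])
       (auto simp: eventually_at_filter)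
qed

lemma first_factorial_cumulant_nonpos_imp_zero:
  assumes "has_factorial_cumulant X 1 c" "c \<le> 0"
  shows "X = return_pmf 0"
proof -
  have "pmf X 0 = 1"
    using first_factorial_cumulant_ge[OF assms(1)] assms(2) pmf_le_1[of X 0] by linarith
  then have "AE x in measure_pmf X. x \<in> {0}"
    by (subst measure_pmf.AE_in_set_eq_1) (simp_all add: measure_pmf_single)
  then have "set_pmf X \<subseteq> {0}"
    by (auto simp: AE_measure_pmf_iff)
  then show ?thesis
    by (simp add: set_pmf_subset_singleton)
qed

section \<open>Finite differences\<close>

text \<open>The forward difference with step 1; its iterates are written with \<open>^^\<close>.\<close>

definition fdiff :: "(nat \<Rightarrow> real) \<Rightarrow> nat \<Rightarrow> real" where
  "fdiff f k = f (Suc k) - f k"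

lemma fdiff_funpow_shift: "(fdiff ^^ n) (\<lambda>k. f (Suc k)) k = (fdiff ^^ n) f (Suc k)"
  by (induction n arbitrary: k) (simp_all add: fdiff_def)

lemma fdiff_funpow_zero: "(fdiff ^^ n) (\<lambda>_. 0) k = 0"
  by (induction n arbitrary: k) (simp_all add: fdiff_def)

lemma fdiff_funpow_add: "(fdiff ^^ n) (\<lambda>k. f k + g k) k = (fdiff ^^ n) f k + (fdiff ^^ n) g k"
  by (induction n arbitrary: k) (simp_all add: fdiff_def)

lemma fdiff_funpow_cmult: "(fdiff ^^ n) (\<lambda>k. c * f k) k = c * (fdiff ^^ n) f k"
  by (induction n arbitrary: k) (simp_all add: fdiff_def algebra_simps)

lemma fdiff_funpow_mult_Suc:
  assumes "\<And>k. (fdiff ^^ n) f k = 0"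
  shows "(fdiff ^^ Suc n) (\<lambda>k. real (Suc k) * f k) k = 0"
  using assms
proof (induction n arbitrary: f k)
  case 0
  then show ?case by (simp add: fdiff_def)
next
  case (Suc n)
  have "fdiff (\<lambda>k. real (Suc k) * f k) = (\<lambda>k. real (Suc k) * fdiff f k + f (Suc k))"
    by (auto simp: fdiff_def algebra_simps)
  then have "(fdiff ^^ Suc (Suc n)) (\<lambda>k. real (Suc k) * f k) k =
      (fdiff ^^ Suc n) (\<lambda>k. real (Suc k) * fdiff f k) k + (fdiff ^^ Suc n) f (Suc k)"
    by (simp only: funpow_Suc_right[of "Suc n"] o_apply fdiff_funpow_add fdiff_funpow_shift)
  also have "(fdiff ^^ Suc n) (\<lambda>k. real (Suc k) * fdiff f k) k = 0"
    by (rule Suc.IH) (use Suc.prems in \<open>simp add: funpow_Suc_right del: funpow.simps\<close>)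
  finally show ?case
    using Suc.prems by simp
qed

lemma fdiff_funpow_power:
  assumes "i < n"
  shows "(fdiff ^^ n) (\<lambda>k. real (Suc k) ^ i) k = 0"
  using assms
proof (induction i arbitrary: n k)
  case 0
  then obtain m where "n = Suc m" by (cases n) auto
  moreover have "fdiff (\<lambda>_. 1) = (\<lambda>_. 0)" by (simp add: fdiff_def fun_eq_iff)
  ultimately show ?case
    by (simp add: funpow_Suc_right fdiff_funpow_zero del: funpow.simps)
next
  case (Suc i)
  then obtain m where m: "n = Suc m" "i < m" by (cases n) auto
  show ?case
    using fdiff_funpow_mult_Suc[OF Suc.IH[OF m(2)]] m(1) by simp
qed

text \<open>A sequence annihilated by the \<open>(r+1)\<close>-st difference grows at most like the \<open>r\<close>-th
  power, with a bound proportional to its first \<open>r + 1\<close> values.\<close>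

lemma fdiff_growth:
  assumes "\<And>k. k + Suc r < N \<Longrightarrow> (fdiff ^^ Suc r) f k = 0"
    and "\<And>k. \<lbrakk>k \<le> r; k < N\<rbrakk> \<Longrightarrow> \<bar>f k\<bar> \<le> M"
    and "k < N"
  shows "\<bar>f k\<bar> \<le> 3 ^ r * M * real (Suc k) ^ r"
  using assms
proof (induction r arbitrary: f N M k)
  case 0
  have "f k = f 0" using \<open>k < N\<close>
  proof (induction k)
    case (Suc k)
    then show ?case using "0.prems"(1)[of k] by (simp add: fdiff_def)
  qed simp
  then show ?case using "0.prems"(2)[of 0] "0.prems"(3) by simp
next
  case (Suc r)
  have M: "0 \<le> M"
    using Suc.prems(2)[of 0] Suc.prems(3) by fastforce
  have g: "\<bar>fdiff f j\<bar> \<le> 3 ^ r * (2 * M) * real (Suc j) ^ r" if "j < N - 1" for j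
  proof (rule Suc.IH[OF _ _ that])
    show "(fdiff ^^ Suc r) (fdiff f) i = 0" if "i + Suc r < N - 1" for i
      using Suc.prems(1)[of i] that by (simp add: funpow_swap1)
    show "\<bar>fdiff f i\<bar> \<le> 2 * M" if "i \<le> r" "i < N - 1" for i
      using Suc.prems(2)[of i] Suc.prems(2)[of "Suc i"] that unfolding fdiff_def by fastforce
  qed
  have "f k = f 0 + (\<Sum>j<k. fdiff f j)"
    by (simp add: fdiff_def sum_lessThan_telescope)
  then have "\<bar>f k\<bar> \<le> \<bar>f 0\<bar> + (\<Sum>j<k. \<bar>fdiff f j\<bar>)"
    using sum_abs[of "fdiff f" "{..<k}"] by linarith
  also have "\<dots> \<le> M + (\<Sum>j<k. 3 ^ r * (2 * M) * real (Suc k) ^ r)"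
  proof (intro add_mono sum_mono)
    show "\<bar>f 0\<bar> \<le> M" using Suc.prems(2)[of 0] Suc.prems(3) by simp
    fix j assume "j \<in> {..<k}"
    then show "\<bar>fdiff f j\<bar> \<le> 3 ^ r * (2 * M) * real (Suc k) ^ r"
      using g[of j] Suc.prems(3) M
      by (auto intro!: order.trans[OF g[of j]] mult_left_mono power_mono)
  qed
  also have "\<dots> \<le> 3 ^ r * M * real (Suc k) ^ r + (\<Sum>j<k. 3 ^ r * (2 * M) * real (Suc k) ^ r)"
  proof -
    have "1 * 1 \<le> 3 ^ r * real (Suc k) ^ r"
      by (intro mult_mono one_le_power) auto
    from mult_right_mono[OF this M] show ?thesis by (simp add: mult_ac)
  qed
  also have "\<dots> = 3 ^ r * M * real (Suc k) ^ r * (1 + 2 * real k)"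
    by (simp add: algebra_simps)
  also have "\<dots> \<le> 3 ^ r * M * real (Suc k) ^ r * (3 * real (Suc k))"
    using M by (intro mult_left_mono) auto
  finally show ?case by (simp only: power_Suc mult_ac)
qed

text \<open>On the grid of mesh \<open>1/N\<close> the initial values of \<open>e\<close> are of order \<open>o(1 / N ^ r)\<close>, and the growth up to
  the point \<open>1\<close> costs a factor of order \<open>N ^ r\<close> only.\<close>

lemma flat_zero_fdiff_imp_zero:
  fixes e :: "real \<Rightarrow> real"
  assumes diff: "\<And>N k. k + Suc r < N \<Longrightarrow> (fdiff ^^ Suc r) (\<lambda>k. e (real (Suc k) / real N)) k = 0"
    and flat: "\<And>\<epsilon>. 0 < \<epsilon> \<Longrightarrow> \<exists>\<delta>>0. \<forall>p. 0 < p \<and> p < \<delta> \<longrightarrow> \<bar>e p\<bar> \<le> \<epsilon> * p ^ r"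
  shows "e 1 = 0"
proof -
  define C where "C = 3 ^ r * real (Suc r) ^ r"
  have C: "0 < C" by (simp add: C_def)
  have bound: "\<bar>e 1\<bar> \<le> \<epsilon> * C" if \<epsilon>: "0 < \<epsilon>" for \<epsilon>
  proof -
    obtain \<delta> where \<delta>: "0 < \<delta>" "\<And>p. 0 < p \<Longrightarrow> p < \<delta> \<Longrightarrow> \<bar>e p\<bar> \<le> \<epsilon> * p ^ r"
      using flat[OF \<epsilon>] by blast
    obtain N where N: "real (Suc r) / \<delta> < real N"
      using reals_Archimedean2 by blast
    have N0: "0 < real N"
      by (rule le_less_trans[OF _ N]) (use \<delta>(1) in simp)
    have N\<delta>: "real (Suc r) / real N < \<delta>"
      using N N0 \<delta>(1) by (simp add: field_simps)
    have "\<bar>e (real (Suc (N - 1)) / real N)\<bar> \<le>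
        3 ^ r * (\<epsilon> * (real (Suc r) / real N) ^ r) * real (Suc (N - 1)) ^ r"
    proof (rule fdiff_growth[where f = "\<lambda>k. e (real (Suc k) / real N)" and N = N])
      fix k assume k: "k \<le> r" "k < N"
      have le: "real (Suc k) / real N \<le> real (Suc r) / real N"
        using k by (intro divide_right_mono) auto
      have "\<bar>e (real (Suc k) / real N)\<bar> \<le> \<epsilon> * (real (Suc k) / real N) ^ r"
        using le N\<delta> N0 by (intro \<delta>(2)) auto
      also have "\<dots> \<le> \<epsilon> * (real (Suc r) / real N) ^ r"
        using le \<epsilon> by (intro mult_left_mono power_mono) auto
      finally show "\<bar>e (real (Suc k) / real N)\<bar> \<le> \<epsilon> * (real (Suc r) / real N) ^ r" .
    qed (use diff N0 in auto)
    moreover have "Suc (N - 1) = N" using N0 by simp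
    ultimately show ?thesis
      using N0 by (simp add: C_def power_divide mult_ac)
  qed
  show ?thesis
  proof (rule ccontr)
    assume "e 1 \<noteq> 0"
    then have "0 < \<bar>e 1\<bar> / (2 * C)" using C by simp
    from bound[OF this] show False using C \<open>e 1 \<noteq> 0\<close> by simp
  qed
qed

text \<open>Here \<open>\<Theta>\<close> is only a semigroup, so a difference cannot be formed in it. The iterated difference
  of a sequence in \<open>\<Theta>\<close> is therefore carried along as a pair of elements of \<open>\<Theta>\<close>, whose values under
  the additive function \<open>G\<close> differ by the iterated difference of the values along the sequence. If all coordinates of the
  difference vanish, the two elements coincide.\<close>

lemma fdiff_additive_eq_zero:
  fixes \<Theta> :: "('i \<Rightarrow> real) set" and G :: "('i \<Rightarrow> real) \<Rightarrow> real"
    and c :: "'i \<Rightarrow> nat \<Rightarrow> real" and g :: "nat \<Rightarrow> real"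
  assumes \<Theta>: "\<Theta> \<subseteq> I \<rightarrow>\<^sub>E UNIV"
    and add: "\<And>\<theta> \<eta>. \<lbrakk>\<theta> \<in> \<Theta>; \<eta> \<in> \<Theta>\<rbrakk> \<Longrightarrow>
      \<exists>\<zeta>\<in>\<Theta>. (\<forall>i\<in>I. \<zeta> i = \<theta> i + \<eta> i) \<and> G \<zeta> = G \<theta> + G \<eta>"
    and seq: "\<And>k. k < N \<Longrightarrow> \<exists>\<theta>\<in>\<Theta>. (\<forall>i\<in>I. \<theta> i = c i k) \<and> G \<theta> = g k"
    and zero: "\<And>i. i \<in> I \<Longrightarrow> (fdiff ^^ n) (c i) k = 0"
    and k: "k + n < N"
  shows "(fdiff ^^ n) g k = 0"
proof -
  have "\<exists>\<alpha>\<in>\<Theta>. \<exists>\<beta>\<in>\<Theta>. (\<forall>i\<in>I. \<alpha> i - \<beta> i = (fdiff ^^ n) (c i) k) \<and>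
      G \<alpha> - G \<beta> = (fdiff ^^ n) g k"
    using k
  proof (induction n arbitrary: k)
    case 0
    then obtain \<theta> where \<theta>: "\<theta> \<in> \<Theta>" "\<forall>i\<in>I. \<theta> i = c i k" "G \<theta> = g k"
      using seq[of k] by auto
    \<comment> \<open>\<open>\<Theta>\<close> need not contain 0, so \<open>\<theta>\<close> is written as the difference of \<open>2 * \<theta>\<close> and \<open>\<theta>\<close>.\<close>
    obtain \<zeta> where "\<zeta> \<in> \<Theta>" "\<forall>i\<in>I. \<zeta> i = \<theta> i + \<theta> i" "G \<zeta> = G \<theta> + G \<theta>"
      using add[OF \<theta>(1) \<theta>(1)] by blast
    with \<theta> show ?case
      by (intro bexI[of _ \<zeta>] bexI[of _ \<theta>]) auto
  next
    case (Suc n)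
    obtain \<alpha> \<beta> where 1: "\<alpha> \<in> \<Theta>" "\<beta> \<in> \<Theta>"
        "\<forall>i\<in>I. \<alpha> i - \<beta> i = (fdiff ^^ n) (c i) k"
        "G \<alpha> - G \<beta> = (fdiff ^^ n) g k"
      using Suc.IH[of k] Suc.prems by auto
    obtain \<alpha>' \<beta>' where 2: "\<alpha>' \<in> \<Theta>" "\<beta>' \<in> \<Theta>"
        "\<forall>i\<in>I. \<alpha>' i - \<beta>' i = (fdiff ^^ n) (c i) (Suc k)"
        "G \<alpha>' - G \<beta>' = (fdiff ^^ n) g (Suc k)"
      using Suc.IH[of "Suc k"] Suc.prems by auto
    obtain \<gamma> where 3: "\<gamma> \<in> \<Theta>" "\<forall>i\<in>I. \<gamma> i = \<alpha>' i + \<beta> i" "G \<gamma> = G \<alpha>' + G \<beta>"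
      using add[OF 2(1) 1(2)] by blast
    obtain \<gamma>' where 4: "\<gamma>' \<in> \<Theta>" "\<forall>i\<in>I. \<gamma>' i = \<beta>' i + \<alpha> i" "G \<gamma>' = G \<beta>' + G \<alpha>"
      using add[OF 2(2) 1(1)] by blast
    have "\<gamma> i - \<gamma>' i = (fdiff ^^ Suc n) (c i) k" if "i \<in> I" for i
      using 1(3)[rule_format, OF that] 2(3)[rule_format, OF that] 3(2) 4(2) that
      by (simp add: fdiff_def)
    moreover have "G \<gamma> - G \<gamma>' = (fdiff ^^ Suc n) g k"
      using 1(4) 2(4) 3(3) 4(3) by (simp add: fdiff_def)
    ultimately show ?case
      using 3(1) 4(1) by blast
  qed
  then obtain \<alpha> \<beta> where ab: "\<alpha> \<in> \<Theta>" "\<beta> \<in> \<Theta>" "\<forall>i\<in>I. \<alpha> i - \<beta> i = 0"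
      "G \<alpha> - G \<beta> = (fdiff ^^ n) g k"
    using zero by force
  have "\<alpha> = \<beta>"
    using ab \<Theta> by (intro PiE_ext[of \<alpha> I "\<lambda>_. UNIV"]) auto
  then show ?thesis using ab(4) by simp
qed

section \<open>Taylor expansion at a boundary point\<close>

text \<open>Taylor's formula with Peano remainder, for left derivatives at 1.\<close>

lemma taylor_peano_left:
  fixes D :: "nat \<Rightarrow> real \<Rightarrow> real"
  assumes "\<And>j t. \<lbrakk>j \<le> r; t \<in> {0<..1}\<rbrakk> \<Longrightarrow>
      (D j has_real_derivative D (Suc j) t) (at t within {0<..1})"
    and "0 < \<epsilon>"
  shows "\<exists>\<delta>. 0 < \<delta> \<and> \<delta> \<le> 1 \<and> (\<forall>t. 1 - \<delta> < t \<and> t \<le> 1 \<longrightarrow>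
      \<bar>D 0 t - (\<Sum>i\<le>Suc r. D i 1 / fact i * (t - 1) ^ i)\<bar> \<le> \<epsilon> * (1 - t) ^ Suc r)"
  using assms(1)
proof (induction r arbitrary: D)
  case 0
  have "((\<lambda>t. (D 0 t - D 0 1) / (t - 1)) \<longlongrightarrow> D 1 1) (at 1 within {0<..1})"
    using "0.prems"[of 0 1] by (simp add: has_field_derivative_iff)
  then have "\<forall>\<^sub>F t in at 1 within {0<..1}. dist ((D 0 t - D 0 1) / (t - 1)) (D 1 1) < \<epsilon>"
    using \<open>0 < \<epsilon>\<close> by (rule tendstoD)
  then obtain d where d: "0 < d" and
    close: "\<And>t. \<lbrakk>t \<in> {0<..1}; t \<noteq> 1; dist t 1 < d\<rbrakk> \<Longrightarrow>
      dist ((D 0 t - D 0 1) / (t - 1)) (D 1 1) < \<epsilon>"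
    unfolding eventually_at by auto
  have "\<bar>D 0 t - (\<Sum>i\<le>Suc 0. D i 1 / fact i * (t - 1) ^ i)\<bar> \<le> \<epsilon> * (1 - t) ^ Suc 0"
    if t: "1 - min d 1 < t" "t \<le> 1" for t
  proof (cases "t = 1")
    case False
    have "0 < t" "1 - t < d"
      using t(1) by linarith+
    then have "\<bar>(D 0 t - D 0 1) / (t - 1) - D 1 1\<bar> * \<bar>t - 1\<bar> \<le> \<epsilon> * \<bar>t - 1\<bar>"
      using close[of t] t False by (intro mult_right_mono) (auto simp: dist_real_def)
    moreover have "\<bar>(D 0 t - D 0 1) / (t - 1) - D 1 1\<bar> * \<bar>t - 1\<bar> =
        \<bar>D 0 t - (\<Sum>i\<le>Suc 0. D i 1 / fact i * (t - 1) ^ i)\<bar>"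
      using False by (simp add: field_simps flip: abs_mult)
    ultimately show ?thesis using t by simp
  qed simp
  then show ?case
    using d by (intro exI[of _ "min d 1"]) auto
next
  case (Suc r)
  define R where "R t = D 0 t - (\<Sum>i\<le>Suc (Suc r). D i 1 / fact i * (t - 1) ^ i)" for t
  define R' where "R' t = D 1 t - (\<Sum>i\<le>Suc r. D (Suc i) 1 / fact i * (t - 1) ^ i)" for t
  obtain \<delta> where \<delta>: "0 < \<delta>" "\<delta> \<le> 1"
      "\<And>t. \<lbrakk>1 - \<delta> < t; t \<le> 1\<rbrakk> \<Longrightarrow> \<bar>R' t\<bar> \<le> \<epsilon> * (1 - t) ^ Suc r"
    using Suc.IH[of "\<lambda>j. D (Suc j)"] Suc.prems unfolding R'_def by auto
  have deriv: "(R has_real_derivative R' t) (at t within {0<..1})" if t: "t \<in> {0<..1}" for t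
  proof -
    have R_eq: "R = (\<lambda>t. D 0 t - (D 0 1 + (\<Sum>i\<le>Suc r. D (Suc i) 1 / fact (Suc i) * (t - 1) ^ Suc i)))"
      unfolding R_def by (subst sum.atMost_Suc_shift) simp
    have step: "((\<lambda>t. D (Suc i) 1 / fact (Suc i) * (t - 1) ^ Suc i) has_real_derivative
        D (Suc i) 1 / fact i * (t - 1) ^ i) (at t within {0<..1})" for i
    proof -
      have "((\<lambda>t. D (Suc i) 1 / fact (Suc i) * (t - 1) ^ Suc i) has_real_derivative
          D (Suc i) 1 / fact (Suc i) * ((1 + real i) * (1 * (t - 1) ^ i))) (at t within {0<..1})"
        by (intro DERIV_cmult DERIV_power_Suc) (auto intro!: derivative_eq_intros)
      moreover have "D (Suc i) 1 / fact (Suc i) * (1 + real i) = D (Suc i) 1 / fact i"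
        by (simp add: divide_simps)
      ultimately show ?thesis
        by (simp only: mult_1 flip: mult.assoc)
    qed
    have "(R has_real_derivative D (Suc 0) t - (0 + (\<Sum>i\<le>Suc r. D (Suc i) 1 / fact i * (t - 1) ^ i)))
        (at t within {0<..1})"
      unfolding R_eq using t by (intro DERIV_diff DERIV_add DERIV_const DERIV_sum step Suc.prems) auto
    then show ?thesis
      by (simp only: R'_def add_0 One_nat_def)
  qed
  have "\<bar>R t\<bar> \<le> \<epsilon> * (1 - t) ^ Suc (Suc r)" if t: "1 - \<delta> < t" "t \<le> 1" for t
  proof -
    have "norm (R t - R 1) \<le> \<epsilon> * (1 - t) ^ Suc r * norm (t - 1)"
    proof (rule field_differentiable_bound)
      fix x assume x: "x \<in> {t..1}"
      show "(R has_real_derivative R' x) (at x within {t..1})"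
        by (rule DERIV_subset[OF deriv]) (use x t \<delta> in auto)
      have "\<bar>R' x\<bar> \<le> \<epsilon> * (1 - x) ^ Suc r"
        using x t by (intro \<delta>(3)) auto
      also have "\<dots> \<le> \<epsilon> * (1 - t) ^ Suc r"
        using x \<open>0 < \<epsilon>\<close> by (intro mult_left_mono power_mono) auto
      finally show "norm (R' x) \<le> \<epsilon> * (1 - t) ^ Suc r" by simp
    qed (use t in auto)
    moreover have "R 1 = 0"
      unfolding R_def by (subst sum.atMost_Suc_shift) simp
    ultimately show ?thesis
      using t by (simp add: mult_ac)
  qed
  then show ?case
    using \<delta>(1,2) unfolding R_def by blast
qed

section \<open>Closed models have polynomial log generating functions, and conversely\<close>

text \<open>For \<open>u = 1 - t\<close> the function \<open>G\<close> below is additive on \<open>\<Theta>\<close>, and \<open>e p\<close> is its value at the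
  parameter of the \<open>p\<close>-thinning of the law \<open>F \<theta>\<close>, whose coordinates \<open>p ^ i * \<theta> i\<close> are polynomial
  in \<open>p\<close>. Substituting \<open>p * u\<close> for \<open>u\<close>, \<open>e p\<close> is also the error at \<open>1 - p * u\<close> of the Taylor
  polynomial of \<open>ln \<circ> pgf (F \<theta>)\<close> at 1.\<close>

lemma pgf_eq_exp_if_closed:
  assumes r: "1 \<le> r" and \<Theta>: "\<Theta> \<subseteq> {1..r} \<rightarrow>\<^sub>E UNIV"
    and par: "parameterized_by_factorial_cumulants r \<Theta> F"
    and add: "closed_under_addition (F ` \<Theta>)"
    and thin: "closed_under_binomial_subsampling (F ` \<Theta>)"
    and \<theta>: "\<theta> \<in> \<Theta>" and t: "t \<in> {0<..<1}"
  shows "pgf (F \<theta>) t = exp (\<Sum>i=1..r. \<theta> i / fact i * (t - 1) ^ i)"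
proof -
  have cumulant: "has_factorial_cumulant (F \<eta>) i (\<eta> i)" if "\<eta> \<in> \<Theta>" "i \<in> {1..r}" for \<eta> i
    using par that unfolding parameterized_by_factorial_cumulants_def by blast
  define u where "u = 1 - t"
  have u: "0 < u" "u < 1"
    using t by (auto simp: u_def)
  define G where "G \<eta> = ln (pgf (F \<eta>) (1 - u)) - (\<Sum>i=1..r. \<eta> i / fact i * (- u) ^ i)" for \<eta>
  define e where "e p = ln (pgf (F \<theta>) (1 - p * u)) - (\<Sum>i=1..r. \<theta> i / fact i * (- (p * u)) ^ i)" for p

  have G_add: "\<exists>\<zeta>\<in>\<Theta>. (\<forall>i\<in>{1..r}. \<zeta> i = \<eta> i + \<eta>' i) \<and> G \<zeta> = G \<eta> + G \<eta>'"
    if \<eta>: "\<eta> \<in> \<Theta>" "\<eta>' \<in> \<Theta>" for \<eta> \<eta>'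
  proof -
    obtain \<zeta> where \<zeta>: "\<zeta> \<in> \<Theta>" "F \<zeta> = map_pmf (\<lambda>(x, y). x + y) (pair_pmf (F \<eta>) (F \<eta>'))"
      using add \<eta> unfolding closed_under_addition_def by (metis (no_types, lifting) imageE imageI)
    have coord: "\<zeta> i = \<eta> i + \<eta>' i" if "i \<in> {1..r}" for i
      using has_factorial_cumulant_add[OF cumulant[OF \<eta>(1) that] cumulant[OF \<eta>(2) that]]
        cumulant[OF \<zeta>(1) that] \<zeta>(2) has_factorial_cumulant_unique by simp
    have "0 < pgf (F \<eta>) (1 - u)" "0 < pgf (F \<eta>') (1 - u)"
      using u by (auto intro: pgf_pos)
    then have "G \<zeta> = G \<eta> + G \<eta>'"
      using u coord
      by (simp add: G_def \<zeta>(2) pgf_add ln_mult sum.distrib add_divide_distrib distrib_right)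
    with \<zeta>(1) coord show ?thesis by blast
  qed

  have G_thin: "\<exists>\<zeta>\<in>\<Theta>. (\<forall>i\<in>{1..r}. \<zeta> i = p ^ i * \<theta> i) \<and> G \<zeta> = e p" if p: "p \<in> {0<..1}" for p
  proof -
    obtain \<zeta> where \<zeta>: "\<zeta> \<in> \<Theta>" "F \<zeta> = thinning p (F \<theta>)"
      using thin \<theta> p unfolding closed_under_binomial_subsampling_def
      by (metis (no_types, lifting) imageE imageI)
    have coord: "\<zeta> i = p ^ i * \<theta> i" if "i \<in> {1..r}" for i
      using has_factorial_cumulant_thinning[OF cumulant[OF \<theta> that] p]
        cumulant[OF \<zeta>(1) that] \<zeta>(2) has_factorial_cumulant_unique by simp
    have "pgf (F \<zeta>) (1 - u) = pgf (F \<theta>) (1 - p * u)"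
      using u p by (simp add: \<zeta>(2) pgf_thinning algebra_simps)
    moreover have "\<zeta> i / fact i * (- u) ^ i = \<theta> i / fact i * (- (p * u)) ^ i" if "i \<in> {1..r}" for i
      using coord[OF that] power_mult_distrib[of p "- u" i] by simp
    ultimately have "G \<zeta> = e p"
      by (simp add: G_def e_def)
    with \<zeta>(1) coord show ?thesis by blast
  qed

  have diff: "(fdiff ^^ Suc r) (\<lambda>k. e (real (Suc k) / real N)) k = 0" if "k + Suc r < N" for N k
  proof (rule fdiff_additive_eq_zero[OF \<Theta> G_add _ _ that])
    fix j assume "j < N"
    then show "\<exists>\<zeta>\<in>\<Theta>. (\<forall>i\<in>{1..r}. \<zeta> i = \<theta> i / real N ^ i * real (Suc j) ^ i) \<and>
        G \<zeta> = e (real (Suc j) / real N)"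
      using G_thin[of "real (Suc j) / real N"] by (simp add: power_divide mult_ac)
  next
    fix i assume "i \<in> {1..r}"
    then show "(fdiff ^^ Suc r) (\<lambda>k. \<theta> i / real N ^ i * real (Suc k) ^ i) k = 0"
      using fdiff_funpow_power[of i "Suc r" k] by (simp only: fdiff_funpow_cmult) simp
  qed

  have flat: "\<exists>\<delta>>0. \<forall>p. 0 < p \<and> p < \<delta> \<longrightarrow> \<bar>e p\<bar> \<le> \<epsilon> * p ^ r" if \<epsilon>: "0 < \<epsilon>" for \<epsilon>
  proof -
    obtain D where D: "\<forall>s\<in>{0<..1}. D 0 s = ln (pgf (F \<theta>) s)"
        "\<forall>j<r. \<forall>s\<in>{0<..1}. (D j has_real_derivative D (Suc j) s) (at s within {0<..1})"
      using cumulant[OF \<theta>, of r] r unfolding has_factorial_cumulant_def by auto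
    have D_1: "D i 1 = \<theta> i" if "i \<in> {1..r}" for i
    proof -
      have "has_factorial_cumulant (F \<theta>) i (D i 1)"
        unfolding has_factorial_cumulant_def using D that by (intro exI[of _ D]) auto
      then show ?thesis
        using cumulant[OF \<theta> that] has_factorial_cumulant_unique by blast
    qed
    have D_0: "D 0 1 = 0"
      using D(1) by simp
    obtain r' where r': "r = Suc r'"
      using r by (cases r) auto
    have split: "(\<Sum>i\<le>r. D i 1 / fact i * x ^ i) = (\<Sum>i=1..r. \<theta> i / fact i * x ^ i)" for x
    proof -
      have "{..r} = insert 0 {1..r}" by auto
      then show ?thesis using D_0 D_1 by simp
    qed
    obtain \<delta> where \<delta>: "0 < \<delta>" "\<delta> \<le> 1"
      "\<And>s. \<lbrakk>1 - \<delta> < s; s \<le> 1\<rbrakk> \<Longrightarrow>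
        \<bar>D 0 s - (\<Sum>i=1..r. \<theta> i / fact i * (s - 1) ^ i)\<bar> \<le> \<epsilon> * (1 - s) ^ r"
      using taylor_peano_left[of r' D \<epsilon>] D(2) \<epsilon> split r' by (auto simp: less_Suc_eq_le)
    show ?thesis
    proof (intro exI[of _ \<delta>] conjI allI impI)
      fix p assume p: "0 < p \<and> p < \<delta>"
      have pu: "0 < p * u" "p * u \<le> p"
        using p u by (auto simp: mult_left_le)
      have "\<bar>e p\<bar> \<le> \<epsilon> * (p * u) ^ r"
        using \<delta>(3)[of "1 - p * u"] D(1)[rule_format, of "1 - p * u"] pu p \<delta>(2) by (simp add: e_def)
      also have "\<dots> \<le> \<epsilon> * p ^ r"
        using pu \<epsilon> by (intro mult_left_mono power_mono) auto
      finally show "\<bar>e p\<bar> \<le> \<epsilon> * p ^ r" .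
    qed (fact \<delta>(1))
  qed

  have "e 1 = 0"
    using diff flat by (rule flat_zero_fdiff_imp_zero)
  then have "ln (pgf (F \<theta>) t) = (\<Sum>i=1..r. \<theta> i / fact i * (t - 1) ^ i)"
    by (simp add: e_def u_def)
  moreover have "0 < pgf (F \<theta>) t"
    using t by (auto intro: pgf_pos)
  ultimately show ?thesis
    by (metis exp_ln)
qed

text \<open>The widest domain contains every admissible parameter with positive mean only. The law with
  mean 0 is the point mass at 0, neutral for addition and fixed by thinning, so it is treated apart.\<close>

lemma closed_if_pgf_eq_exp:
  assumes r: "1 \<le> r" and \<Theta>: "\<Theta> \<subseteq> {1..r} \<rightarrow>\<^sub>E UNIV"
    and par: "parameterized_by_factorial_cumulants r \<Theta> F"
    and pgf: "\<And>\<theta> t. \<lbrakk>\<theta> \<in> \<Theta>; t \<in> {0<..<1}\<rbrakk> \<Longrightarrow>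
      pgf (F \<theta>) t = exp (\<Sum>i=1..r. \<theta> i / fact i * (t - 1) ^ i)"
    and widest: "\<And>\<theta>. \<lbrakk>\<theta> \<in> {1..r} \<rightarrow>\<^sub>E UNIV; 0 < \<theta> 1;
      is_pgf (\<lambda>t. exp (\<Sum>i=1..r. \<theta> i / fact i * (t - 1) ^ i))\<rbrakk> \<Longrightarrow> \<theta> \<in> \<Theta>"
  shows "closed_under_addition (F ` \<Theta>)" "closed_under_binomial_subsampling (F ` \<Theta>)"
proof -
  have mem: "Z \<in> F ` \<Theta>"
    if \<eta>: "0 < \<eta> 1"
      and Z: "\<And>t. t \<in> {0<..<1} \<Longrightarrow> pgf Z t = exp (\<Sum>i=1..r. \<eta> i / fact i * (t - 1) ^ i)" for Z \<eta>
  proof -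
    define \<zeta> where "\<zeta> = restrict \<eta> {1..r}"
    have Z': "pgf Z t = exp (\<Sum>i=1..r. \<zeta> i / fact i * (t - 1) ^ i)" if "t \<in> {0<..<1}" for t
      using Z[OF that] by (simp add: \<zeta>_def)
    have "\<zeta> \<in> \<Theta>"
    proof (rule widest)
      show "is_pgf (\<lambda>t. exp (\<Sum>i=1..r. \<zeta> i / fact i * (t - 1) ^ i))"
        unfolding is_pgf_def using Z' by (intro exI[of _ Z]) simp
    qed (use r \<eta> in \<open>auto simp: \<zeta>_def\<close>)
    moreover have "F \<zeta> = Z"
      using pgf[OF \<open>\<zeta> \<in> \<Theta>\<close>] Z' by (intro pgf_inject) simp
    ultimately show ?thesis by blast
  qed
  have degenerate: "pgf (F \<theta>) t = 1" if "\<theta> \<in> \<Theta>" "\<not> 0 < \<theta> 1" for \<theta> t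
  proof -
    have "F \<theta> = return_pmf 0"
      using par r that unfolding parameterized_by_factorial_cumulants_def
      by (intro first_factorial_cumulant_nonpos_imp_zero[of _ "\<theta> 1"]) auto
    then show ?thesis
      by (simp add: pgf_def)
  qed
  show "closed_under_addition (F ` \<Theta>)"
    unfolding closed_under_addition_def
  proof (intro ballI)
    fix X Y assume "X \<in> F ` \<Theta>" "Y \<in> F ` \<Theta>"
    then obtain \<theta> \<eta> where X: "X = F \<theta>" "\<theta> \<in> \<Theta>" and Y: "Y = F \<eta>" "\<eta> \<in> \<Theta>"
      by blast
    let ?Z = "map_pmf (\<lambda>(x, y). x + y) (pair_pmf X Y)"
    consider "\<not> 0 < \<theta> 1" | "\<not> 0 < \<eta> 1" | "0 < \<theta> 1" "0 < \<eta> 1"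
      by blast
    then show "?Z \<in> F ` \<Theta>"
    proof cases
      case 1
      then have "?Z = Y"
        using degenerate[OF X(2)] by (intro pgf_inject) (simp add: pgf_add X(1))
      then show ?thesis using Y by blast
    next
      case 2
      then have "?Z = X"
        using degenerate[OF Y(2)] by (intro pgf_inject) (simp add: pgf_add Y(1))
      then show ?thesis using X by blast
    next
      case 3
      then show ?thesis
        using X Y by (intro mem[of "\<lambda>i. \<theta> i + \<eta> i"])
          (simp_all add: pgf_add pgf add_divide_distrib distrib_right sum.distrib exp_add)
    qed
  qed
  show "closed_under_binomial_subsampling (F ` \<Theta>)"
    unfolding closed_under_binomial_subsampling_def
  proof (intro ballI)
    fix X and p :: real assume "X \<in> F ` \<Theta>" and p: "p \<in> {0<..1}"
    then obtain \<theta> where X: "X = F \<theta>" "\<theta> \<in> \<Theta>"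
      by blast
    show "thinning p X \<in> F ` \<Theta>"
    proof (cases "0 < \<theta> 1")
      case True
      show ?thesis
      proof (rule mem[of "\<lambda>i. p ^ i * \<theta> i"])
        fix t :: real assume t: "t \<in> {0<..<1}"
        have q: "1 - p + p * t \<in> {0<..<1}"
        proof -
          have "0 < p * t" "p * t < p" using p t by auto
          then show ?thesis using p by simp
        qed
        have "pgf (thinning p X) t = exp (\<Sum>i=1..r. \<theta> i / fact i * (p * (t - 1)) ^ i)"
          using p t pgf[OF X(2) q] by (simp add: pgf_thinning X(1) algebra_simps)
        then show "pgf (thinning p X) t = exp (\<Sum>i=1..r. p ^ i * \<theta> i / fact i * (t - 1) ^ i)"
          by (simp add: power_mult_distrib mult_ac)
      qed (use True p in simp)
    next
      case False
      then have "thinning p X = X"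
        using degenerate[OF X(2) False] p by (intro pgf_inject) (simp add: pgf_thinning X(1))
      then show ?thesis using X by blast
    qed
  qed
qed

theorem theorem1:
  fixes r :: nat
    and \<Theta> :: "(nat \<Rightarrow> real) set"
    and F :: "(nat \<Rightarrow> real) \<Rightarrow> nat pmf"
    and \<Phi> :: "real \<Rightarrow> (nat \<Rightarrow> real) \<Rightarrow> real"
  assumes "r \<ge> 1"
    and "count_model r \<Theta> F \<Phi>"
    and "parameterized_by_factorial_cumulants r \<Theta> F"
    and "widest_parameter_domain r \<Theta> \<Phi>"
  shows "closed_under_addition (F ` \<Theta>) \<and> closed_under_binomial_subsampling (F ` \<Theta>) \<longleftrightarrow>
    (\<forall>\<theta>\<in>\<Theta>. \<forall>t\<in>{0<..<1}. \<Phi> t \<theta> = exp (\<Sum>i=1..r. \<theta> i / fact i * (t - 1) ^ i))"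
proof -
  have \<Theta>: "\<Theta> \<subseteq> {1..r} \<rightarrow>\<^sub>E UNIV"
    and \<Phi>: "\<And>\<theta> t. \<lbrakk>\<theta> \<in> \<Theta>; t \<in> {0<..<1}\<rbrakk> \<Longrightarrow> \<Phi> t \<theta> = pgf (F \<theta>) t"
    using assms(2) unfolding count_model_def by blast+
  show ?thesis
  proof
    assume "closed_under_addition (F ` \<Theta>) \<and> closed_under_binomial_subsampling (F ` \<Theta>)"
    then show "\<forall>\<theta>\<in>\<Theta>. \<forall>t\<in>{0<..<1}. \<Phi> t \<theta> = exp (\<Sum>i=1..r. \<theta> i / fact i * (t - 1) ^ i)"
      using pgf_eq_exp_if_closed[OF assms(1) \<Theta> assms(3)] \<Phi> by simp
  next
    assume eq: "\<forall>\<theta>\<in>\<Theta>. \<forall>t\<in>{0<..<1}. \<Phi> t \<theta> = exp (\<Sum>i=1..r. \<theta> i / fact i * (t - 1) ^ i)"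
    then have widest: "\<theta> \<in> \<Theta>" if "\<theta> \<in> {1..r} \<rightarrow>\<^sub>E UNIV" "0 < \<theta> 1"
        "is_pgf (\<lambda>t. exp (\<Sum>i=1..r. \<theta> i / fact i * (t - 1) ^ i))" for \<theta>
      using assms(4) that unfolding widest_parameter_domain_def by blast
    have "pgf (F \<theta>) t = exp (\<Sum>i=1..r. \<theta> i / fact i * (t - 1) ^ i)"
      if "\<theta> \<in> \<Theta>" "t \<in> {0<..<1}" for \<theta> t
      using eq \<Phi> that by simp
    from closed_if_pgf_eq_exp[OF assms(1) \<Theta> assms(3) this widest]
    show "closed_under_addition (F ` \<Theta>) \<and> closed_under_binomial_subsampling (F ` \<Theta>)"
      by blast
  qed
qed

end
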